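(* Let $\alpha\in-\mathbb N=\{-1,-2,-3,\dots\}$ and let $m,n$ be integers with $m,n\geq|\alpha|$. Then, in the sense of usual (convergent) integrals, $$\int_0^\infty L_m^\alpha(z)\,L_n^\alpha(z)\,z^\alpha e^{-z}\,dz=\frac{\Gamma(1+n+\alpha)}{n!}\,\delta_{m,n}=\frac{(n-|\alpha|)!}{n!}\,\delta_{m,n}.$$
   Context: Laguerre polynomials: for $\alpha\in\mathbb C$ and $n\in\mathbb N_0$, $$L_n^\alpha(z):=\frac1{n!}e^zz^{-\alpha}\partial_z^n\big(e^{-z}z^{n+\alpha}\big)=(-1)^n\sum_{k=0}^n\frac{(-\alpha-n)_{n-k}\,z^k}{k!\,(n-k)!},$$ where $(a)_k=a(a+1)\cdots(a+k-1)$. $\delta_{m,n}$ is the Kronecker delta. *)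

theory Defs
  imports "HOL-Complex_Analysis.Complex_Analysis"
begin

text \<open>The closed form is taken as the definition because it is meaningful at every complex \<open>z\<close>;
  the Rodrigues formula involves the branch cut of \<open>powr\<close> and is proved below off that cut.\<close>

definition laguerre :: "nat \<Rightarrow> complex \<Rightarrow> complex \<Rightarrow> complex" where
  "laguerre n \<alpha> z =
     (-1) ^ n * (\<Sum>k=0..n. pochhammer (- \<alpha> - of_nat n) (n - k) * z ^ k / (fact k * fact (n - k)))"

lemma higher_deriv_powr:
  fixes z a :: complex
  assumes "z \<notin> \<real>\<^sub>\<le>\<^sub>0"
  shows "(deriv ^^ i) (\<lambda>w. w powr a) z = (-1) ^ i * pochhammer (- a) i * z powr (a - of_nat i)"
  using assms
proof (induction i arbitrary: z)
  case (Suc i)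
  have op: "open (- \<real>\<^sub>\<le>\<^sub>0 :: complex set)" by (simp add: open_Compl)
  have "eventually (\<lambda>w. (deriv ^^ i) (\<lambda>w. w powr a) w =
          (-1) ^ i * pochhammer (- a) i * w powr (a - of_nat i)) (nhds z)"
    using eventually_nhds_in_open[OF op, of z] Suc.prems
    by (auto elim!: eventually_mono simp: Suc.IH)
  hence "(deriv ^^ Suc i) (\<lambda>w. w powr a) z =
      deriv (\<lambda>w. (-1) ^ i * pochhammer (- a) i * w powr (a - of_nat i)) z"
    by (simp add: deriv_cong_ev)
  also have "\<dots> = (-1) ^ i * pochhammer (- a) i * ((a - of_nat i) * z powr (a - of_nat i - 1))"
    by (intro DERIV_imp_deriv DERIV_cmult has_field_derivative_powr Suc.prems)
  also have "\<dots> = (-1) ^ Suc i * pochhammer (- a) (Suc i) * z powr (a - of_nat (Suc i))"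
    by (simp add: pochhammer_Suc algebra_simps)
  finally show ?case .
qed auto

lemma higher_deriv_exp_minus:
  "(deriv ^^ i) (\<lambda>w. exp (- w)) (z :: complex) = (-1) ^ i * exp (- z)"
proof (induction i arbitrary: z)
  case (Suc i)
  hence "(deriv ^^ i) (\<lambda>w::complex. exp (- w)) = (\<lambda>z. (-1) ^ i * exp (- z))" by blast
  moreover have "deriv (\<lambda>z::complex. (-1) ^ i * exp (- z)) z = (-1) ^ Suc i * exp (- z)"
    by (rule DERIV_imp_deriv) (auto intro!: derivative_eq_intros)
  ultimately show ?case by simp
qed auto

lemma laguerre_rodrigues:
  fixes z \<alpha> :: complex
  assumes z: "z \<notin> \<real>\<^sub>\<le>\<^sub>0"
  shows "laguerre n \<alpha> z = 1 / fact n * exp z * z powr (- \<alpha>) *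
           (deriv ^^ n) (\<lambda>w. exp (- w) * w powr (of_nat n + \<alpha>)) z"
proof -
  have z0: "z \<noteq> 0" using z by auto
  have "(deriv ^^ n) (\<lambda>w. exp (- w) * w powr (of_nat n + \<alpha>)) z =
     (\<Sum>i=0..n. of_nat (n choose i) * (deriv ^^ i) (\<lambda>w. exp (- w)) z *
        (deriv ^^ (n - i)) (\<lambda>w. w powr (of_nat n + \<alpha>)) z)"
    by (rule higher_deriv_mult[where S = "- \<real>\<^sub>\<le>\<^sub>0"])
       (use z in \<open>auto intro!: holomorphic_intros simp: open_Compl\<close>)
  also have "\<dots> = (\<Sum>i=0..n. fact n * exp (- z) * z powr \<alpha> * (-1) ^ n *
      (pochhammer (- \<alpha> - of_nat n) (n - i) * z ^ i / (fact i * fact (n - i))))"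
  proof (rule sum.cong)
    fix i assume i: "i \<in> {0..n}"
    have e: "of_nat n + \<alpha> - of_nat (n - i) = \<alpha> + of_nat i" using i by (simp add: of_nat_diff)
    have p: "z powr (\<alpha> + of_nat i) = z powr \<alpha> * z ^ i"
      using z0 by (simp add: powr_add powr_nat')
    have s: "(-1) ^ n = (-1) ^ i * ((-1) ^ (n - i) :: complex)"
      using i by (simp flip: power_add)
    show "of_nat (n choose i) * (deriv ^^ i) (\<lambda>w. exp (- w)) z *
        (deriv ^^ (n - i)) (\<lambda>w. w powr (of_nat n + \<alpha>)) z =
      fact n * exp (- z) * z powr \<alpha> * (-1) ^ n *
      (pochhammer (- \<alpha> - of_nat n) (n - i) * z ^ i / (fact i * fact (n - i)))"
      using i unfolding higher_deriv_exp_minus higher_deriv_powr[OF z] e p s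
      by (simp add: binomial_fact algebra_simps)
  qed simp
  also have "\<dots> = fact n * exp (- z) * z powr \<alpha> * laguerre n \<alpha> z"
    by (simp add: laguerre_def sum_distrib_left mult_ac)
  finally show ?thesis using z0
    by (simp add: exp_minus powr_minus field_simps)
qed

end

theory Submission
  imports Defs "HOL-Probability.Distributions"
begin

text \<open>For \<open>\<alpha> = -a\<close> and \<open>n = N + a\<close> the coefficients of index below \<open>a\<close> vanish and
  \<open>L\<^sub>n(z) = (-z)\<^sup>a p\<^sub>N(z)\<close> with \<open>p\<^sub>N(z) = \<Sum>\<^sub>j (-1)\<^sup>j (N choose j) z\<^sup>j / (j + a)!\<close>. Hence the
  factor \<open>z\<^sup>\<alpha>\<close> is absorbed and the claim is the orthogonality of the \<open>p\<^sub>N\<close> for the weight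
  \<open>z\<^sup>a e\<^sup>-\<^sup>z\<close>. The moment \<open>\<integral> z\<^sup>i\<^sup>+\<^sup>a p\<^sub>N(z) e\<^sup>-\<^sup>z dz\<close> is, up to sign, the \<open>N\<close>-th finite difference
  of the polynomial \<open>j \<mapsto> (i + j + a)! / (j + a)!\<close> of degree \<open>i\<close>: it vanishes for \<open>i < N\<close> and is
  \<open>(-1)\<^sup>N N!\<close> for \<open>i = N\<close>.\<close>

text \<open>Pascal's rule. When \<open>f j\<close> carries the sign \<open>(-1) ^ j\<close>, the sum
  \<open>f j + f (Suc j)\<close> becomes a difference of consecutive values, which drives the
  induction below.\<close>

lemma sum_choose_Suc:
  fixes f :: "nat \<Rightarrow> 'a::comm_ring_1"
  shows "(\<Sum>j\<le>Suc n. of_nat (Suc n choose j) * f j) =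
         (\<Sum>j\<le>n. of_nat (n choose j) * (f j + f (Suc j)))"
proof -
  have "(\<Sum>j\<le>Suc n. of_nat (Suc n choose j) * f j) =
        f 0 + (\<Sum>j\<le>n. of_nat (n choose Suc j) * f (Suc j)) + (\<Sum>j\<le>n. of_nat (n choose j) * f (Suc j))"
    by (subst sum.atMost_Suc_shift) (simp add: algebra_simps sum.distrib)
  also have "f 0 + (\<Sum>j\<le>n. of_nat (n choose Suc j) * f (Suc j)) =
      (\<Sum>j\<le>Suc n. of_nat (n choose j) * f j)"
    by (subst sum.atMost_Suc_shift) simp
  finally show ?thesis
    by (simp add: algebra_simps sum.distrib binomial_eq_0)
qed

text \<open>Each differencing in \<open>b\<close> lowers the index \<open>i\<close> by one, up to
  sign, until it is used up. The base point \<open>b\<close> stays arbitrary because the induction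
  step needs both \<open>b\<close> and \<open>Suc b\<close>.\<close>

lemma alternating_sum_choose_shifted:
  "(\<Sum>j\<le>N. of_nat (N choose j) * ((-1) ^ j * of_nat (b + j choose i))) =
     (if i < N then 0 else (-1) ^ N * of_nat (b choose (i - N)) :: 'a::comm_ring_1)"
proof (induction N arbitrary: b)
  case (Suc N)
  have "(\<Sum>j\<le>Suc N. of_nat (Suc N choose j) * ((-1) ^ j * of_nat (b + j choose i))) =
      (\<Sum>j\<le>N. of_nat (N choose j) * ((-1) ^ j * of_nat (b + j choose i)))
      - (\<Sum>j\<le>N. of_nat (N choose j) * ((-1) ^ j * of_nat (Suc b + j choose i)) :: 'a)"
    unfolding sum_choose_Suc by (simp add: algebra_simps sum_subtractf)
  also have "\<dots> = (if i < Suc N then 0 else (-1) ^ Suc N * of_nat (b choose (i - Suc N)))"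
  \<comment> \<open>If \<open>N < i\<close>, Pascal's rule gives the difference. If
    \<open>i = N\<close>, both sums equal \<open>(-1) ^ N\<close> and cancel; if
    \<open>i < N\<close>, both vanish.\<close>
  proof (cases "N < i")
    case True
    then obtain d where "i = Suc (N + d)" using less_iff_Suc_add by auto
    then show ?thesis unfolding Suc.IH by (simp add: algebra_simps Suc_diff_le)
  next
    case False
    then show ?thesis unfolding Suc.IH by auto
  qed
  finally show ?case .
qed simp

text \<open>This is the classical polynomial of parameter \<open>a\<close> and degree
  \<open>N\<close>, rescaled:
  \<open>fact N / fact (N + a) * laguerre N (of_nat a) z\<close>.\<close>

definition reduced_laguerre :: "nat \<Rightarrow> nat \<Rightarrow> complex \<Rightarrow> complex" where
  "reduced_laguerre a N z = (\<Sum>j\<le>N. of_nat (N choose j) * ((-1) ^ j * z ^ j / fact (j + a)))"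

lemma laguerre_negative_parameter:
  "laguerre (N + a) (- of_nat a) z = (- z) ^ a * reduced_laguerre a N z"
proof -
  let ?t = "\<lambda>k. pochhammer (- of_nat N :: complex) (N + a - k) * z ^ k / (fact k * fact (N + a - k))"
  have "laguerre (N + a) (- of_nat a) z = (-1) ^ (N + a) * (\<Sum>k\<in>{0..N+a}. ?t k)"
    by (simp add: laguerre_def)
  \<comment> \<open>For \<open>k < a\<close> the Pochhammer symbol has more than \<open>N\<close>
    factors, so starting from \<open>-N\<close> it runs through 0.\<close>
  also have "(\<Sum>k\<in>{0..N+a}. ?t k) = (\<Sum>k\<in>{a..N+a}. ?t k)"
    by (rule sum.mono_neutral_right) (auto simp: pochhammer_of_nat_eq_0_iff)
  also have "\<dots> = (\<Sum>j\<le>N. ?t (j + a))"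
    using sum.shift_bounds_cl_nat_ivl[of ?t 0 a N] by (simp add: atMost_atLeast0)
  also have "(-1) ^ (N + a) * \<dots> = (- z) ^ a * reduced_laguerre a N z"
    unfolding reduced_laguerre_def sum_distrib_left
  proof (rule sum.cong)
    fix j assume "j \<in> {..N}"
    then obtain d where N: "N = j + d" using le_Suc_ex by auto
    then have d: "N - j = d" by simp
    \<comment> \<open>Reversing the factors of \<open>pochhammer (-N) d\<close> gives
      \<open>(-1) ^ d\<close> times the rising product from \<open>j + 1\<close> to
      \<open>N\<close>.\<close>
    have "fact N = fact j * (pochhammer (of_nat j + 1) d :: complex)"
      using pochhammer_product'[of "1 :: complex" j d]
      by (simp add: N pochhammer_fact add.commute)
    then have p: "pochhammer (- of_nat N :: complex) d = (-1) ^ d * fact N / fact j"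
      using pochhammer_minus[of "of_nat N :: complex" d] by (simp add: N)
    show "(-1) ^ (N + a) * ?t (j + a) =
      (- z) ^ a * (of_nat (N choose j) * ((-1) ^ j * z ^ j / fact (j + a)))"
      unfolding add_diff_cancel_right d p
      by (simp add: N binomial_fact power_add power_minus[of z] field_simps)
  qed simp
  finally show ?thesis .
qed

lemma has_bochner_integral_power_exp:
  "has_bochner_integral lborel
     (\<lambda>x::real. indicator {0<..} x *\<^sub>R (complex_of_real x ^ k * exp (- of_real x))) (fact k)"
proof -
  have "has_bochner_integral lborel (\<lambda>x::real. x ^ k * exp (- x) * indicator {0..} x) (fact k)"
  proof (rule has_bochner_integral_nn_integral)
    show "(\<integral>\<^sup>+ x. ennreal (x ^ k * exp (- x) * indicator {0..} x) \<partial>lborel) = ennreal (fact k)"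
      using nn_intergal_power_times_exp_Ici[of k]
      by (simp add: indicator_mult_ennreal mult.commute)
  qed (auto simp: indicator_def)
  then have "has_bochner_integral lborel
      (\<lambda>x. complex_of_real (x ^ k * exp (- x) * indicator {0..} x)) (of_real (fact k))"
    by (rule has_bochner_integral_of_real)
  \<comment> \<open>The closed and open half-lines differ only at 0, a null set; the values there
    disagree when \<open>k = 0\<close>.\<close>
  moreover have "AE x in lborel. complex_of_real (x ^ k * exp (- x) * indicator {0..} x) =
      indicator {0<..} x *\<^sub>R (complex_of_real x ^ k * exp (- of_real x))"
    using AE_lborel_singleton[of "0::real"]
    by eventually_elim (auto simp: indicator_def exp_of_real simp flip: of_real_minus)
  ultimately show ?thesis
    by (subst (asm) has_bochner_integral_cong_AE) auto
qed

lemma has_bochner_integral_moment_reduced_laguerre: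
  assumes "i \<le> N"
  shows "has_bochner_integral lborel
     (\<lambda>x::real. indicator {0<..} x *\<^sub>R
        (of_real x ^ (i + a) * reduced_laguerre a N (of_real x) * exp (- of_real x)))
     (if i = N then (-1) ^ N * fact N else 0)"
proof -
  have "has_bochner_integral lborel
     (\<lambda>x::real. \<Sum>j\<le>N. (of_nat (N choose j) * (-1) ^ j / fact (j + a)) *
        (indicator {0<..} x *\<^sub>R (complex_of_real x ^ (i + j + a) * exp (- of_real x))))
     (\<Sum>j\<le>N. (of_nat (N choose j) * (-1) ^ j / fact (j + a)) * fact (i + j + a))"
    by (intro has_bochner_integral_sum has_bochner_integral_mult_right
          has_bochner_integral_power_exp)
  also have "(\<lambda>x::real. \<Sum>j\<le>N. (of_nat (N choose j) * (-1) ^ j / fact (j + a)) *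
        (indicator {0<..} x *\<^sub>R (complex_of_real x ^ (i + j + a) * exp (- of_real x)))) =
     (\<lambda>x. indicator {0<..} x *\<^sub>R
        (of_real x ^ (i + a) * reduced_laguerre a N (of_real x) * exp (- of_real x)))"
    by (simp add: reduced_laguerre_def sum_distrib_left sum_distrib_right scaleR_sum_right
          power_add mult_ac)
  \<comment> \<open>The quotient of factorials is \<open>fact i\<close> times the binomial
    coefficient of \<open>i + j + a\<close> over \<open>i\<close>, so the finite difference is taken
    at base point \<open>i + a\<close>.\<close>
  also have "(\<Sum>j\<le>N. (of_nat (N choose j) * (-1) ^ j / fact (j + a)) * fact (i + j + a)) =
      fact i * (\<Sum>j\<le>N. of_nat (N choose j) * ((-1) ^ j * complex_of_nat ((i + a) + j choose i)))"
    unfolding sum_distrib_left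
    by (rule sum.cong) (simp_all add: binomial_fact field_simps)
  also have "\<dots> = (if i = N then (-1) ^ N * fact N else 0)"
    unfolding alternating_sum_choose_shifted using assms by auto
  finally show ?thesis .
qed

text \<open>Expanding the factor of lower degree leaves only moments with \<open>i \<le> N\<close>.
  The sole survivor is \<open>i = M = N\<close>, where the sign of the leading coefficient cancels
  that of the moment.\<close>

lemma has_bochner_integral_reduced_laguerre_le:
  assumes "M \<le> N"
  shows "has_bochner_integral lborel
     (\<lambda>x::real. indicator {0<..} x *\<^sub>R
        (of_real x ^ a * reduced_laguerre a M (of_real x) * reduced_laguerre a N (of_real x)
           * exp (- of_real x)))
     (if M = N then fact N / fact (N + a) else 0)"
proof -
  let ?c = "\<lambda>i. of_nat (M choose i) * (-1) ^ i / fact (i + a) :: complex"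
  have "has_bochner_integral lborel
     (\<lambda>x::real. \<Sum>i\<le>M. ?c i * (indicator {0<..} x *\<^sub>R
        (of_real x ^ (i + a) * reduced_laguerre a N (of_real x) * exp (- of_real x))))
     (\<Sum>i\<le>M. ?c i * (if i = N then (-1) ^ N * fact N else 0))"
    using assms
    by (intro has_bochner_integral_sum has_bochner_integral_mult_right
          has_bochner_integral_moment_reduced_laguerre) auto
  also have "(\<lambda>x::real. \<Sum>i\<le>M. ?c i * (indicator {0<..} x *\<^sub>R
        (of_real x ^ (i + a) * reduced_laguerre a N (of_real x) * exp (- of_real x)))) =
     (\<lambda>x. indicator {0<..} x *\<^sub>R
        (of_real x ^ a * reduced_laguerre a M (of_real x) * reduced_laguerre a N (of_real x)
           * exp (- of_real x)))"
    by (simp add: reduced_laguerre_def[of a M] sum_distrib_left sum_distrib_right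
          scaleR_sum_right power_add mult_ac)
  also have "(\<Sum>i\<le>M. ?c i * (if i = N then (-1) ^ N * fact N else 0)) =
      (if M = N then fact N / fact (N + a) else 0)"
    using assms by (auto simp: if_distrib[of "\<lambda>t. _ * t"] sum.delta simp flip: power_add cong: if_cong)
  finally show ?thesis .
qed

lemma has_bochner_integral_reduced_laguerre:
  "has_bochner_integral lborel
     (\<lambda>x::real. indicator {0<..} x *\<^sub>R
        (of_real x ^ a * reduced_laguerre a M (of_real x) * reduced_laguerre a N (of_real x)
           * exp (- of_real x)))
     (if M = N then fact N / fact (N + a) else 0)"
proof (cases "M \<le> N")
  case False
  then show ?thesis
    using has_bochner_integral_reduced_laguerre_le[of N M a] by (simp add: mult_ac)
qed (rule has_bochner_integral_reduced_laguerre_le)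

theorem theorem3p3:
  fixes \<alpha> :: int and m n :: nat
  assumes "\<alpha> < 0" and "int m \<ge> \<bar>\<alpha>\<bar>" and "int n \<ge> \<bar>\<alpha>\<bar>"
  shows
    "set_integrable lborel {0<..} (\<lambda>z::real.
        laguerre m (of_int \<alpha>) (of_real z) * laguerre n (of_int \<alpha>) (of_real z)
          * of_real z powr of_int \<alpha> * exp (- of_real z)) \<and>
     (LBINT z:{0<..}.
        laguerre m (of_int \<alpha>) (of_real z) * laguerre n (of_int \<alpha>) (of_real z)
          * of_real z powr of_int \<alpha> * exp (- of_real z))
      = Gamma (1 + of_nat n + of_int \<alpha>) / fact n * (if m = n then 1 else 0) \<and>
     Gamma (1 + of_nat n + of_int \<alpha>) / fact n * (if m = n then 1 else 0)
      = (fact (nat (int n - \<bar>\<alpha>\<bar>)) / fact n * (if m = n then 1 else 0) :: complex)"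
proof -
  define a M N where "a = nat \<bar>\<alpha>\<bar>" "M = m - a" "N = n - a"
  have \<alpha>: "\<alpha> = - int a" and m: "m = M + a" and n: "n = N + a"
    using assms by (auto simp: a_M_N_def)
  have integrand: "laguerre m (of_int \<alpha>) (of_real x) * laguerre n (of_int \<alpha>) (of_real x)
          * of_real x powr of_int \<alpha> * exp (- of_real x) =
        of_real x ^ a * reduced_laguerre a M (of_real x) * reduced_laguerre a N (of_real x)
           * exp (- of_real x)" if "x > 0" for x :: real
  proof -
    have "complex_of_real x powr - of_nat a = inverse (of_real x ^ a)"
      using that by (simp add: powr_minus powr_nat')
    moreover have "(- complex_of_real x) ^ a * (- complex_of_real x) ^ a = of_real x ^ a * of_real x ^ a"
      by (simp flip: power_mult_distrib)
    \<comment> \<open>The two factors \<open>(-x) ^ a\<close> contribute \<open>x ^ (2 * a)\<close>,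
      and the weight \<open>x powr -a\<close> removes half of it.\<close>
    ultimately have "of_real x ^ a =
        (- complex_of_real x) ^ a * (- complex_of_real x) ^ a * of_real x powr - of_nat a"
      using that by simp
    then show ?thesis
      by (simp add: m n \<alpha> laguerre_negative_parameter mult_ac)
  qed
  have "has_bochner_integral lborel
     (\<lambda>x::real. indicator {0<..} x *\<^sub>R (laguerre m (of_int \<alpha>) (of_real x)
        * laguerre n (of_int \<alpha>) (of_real x) * of_real x powr of_int \<alpha> * exp (- of_real x)))
     (if M = N then fact N / fact (N + a) else 0)"
    using has_bochner_integral_reduced_laguerre[of a M N]
    \<comment> \<open>Off the open half-line the indicator annihilates both integrands, so the
      identity for positive \<open>x\<close> suffices.\<close>
    by (rule has_bochner_integral_cong[THEN iffD1, rotated -1])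
       (auto simp only: integrand greaterThan_iff scaleR_zero_left simp_thms split: split_indicator)
  moreover have "Gamma (1 + of_nat n + of_int \<alpha>) = (fact N :: complex)"
    by (simp add: n \<alpha> Gamma_fact)
  moreover have "nat (int n - \<bar>\<alpha>\<bar>) = N"
    by (simp add: n \<alpha>)
  ultimately show ?thesis
    by (auto simp: set_integrable_def set_lebesgue_integral_def has_bochner_integral_iff m n)
qed

end
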